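(* Let $M$ be an $n\times n$ matrix over a commutative ring and let $k$ be an integer with $1\le k\le n$. Then for each $j$ with $1\le j\le k$, $$\det(M)\det(M_{[k],[k]})=\sum_{i=1}^k(-1)^{i+j}\det(M_{\{i\},\{j\}})\det(M_{[k]\setminus\{i\},[k]\setminus\{j\}}).$$
   Context: $[k]=\{1,2,\dots,k\}$. For sets $U,W$ of indices with $|U|=|W|$, $M_{U,W}$ denotes the submatrix of $M$ obtained by removing the rows indexed by $U$ and the columns indexed by $W$. The determinant of the empty ($0\times 0$) matrix is $1$. *)

theory Defs
  imports "Jordan_Normal_Form.Determinant" "Jordan_Normal_Form.DL_Submatrix"
begin

text \<open>
  The index sets \<open>U\<close> and \<open>W\<close> are 1-based, whereas matrix entries are addressed from 0, so
  the row numbered \<open>r \<in> U\<close> is the one with matrix index \<open>r - 1\<close>.  \<^const>\<open>submatrix\<close> takes the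
  indices that are kept, in increasing order.
\<close>

definition remove_rows_cols :: "'a mat \<Rightarrow> nat set \<Rightarrow> nat set \<Rightarrow> 'a mat" where
  "remove_rows_cols M U W = submatrix M {r. Suc r \<notin> U} {c. Suc c \<notin> W}"

end

theory Submission
  imports Defs
begin

text \<open>
  Write \<open>S\<close> for the block of \<open>M\<close> in rows and columns \<open>> k\<close>, and let \<open>d i\<close> be the determinant of
  \<open>S\<close> bordered by row \<open>i\<close> and column \<open>j\<close> of \<open>M\<close>.  Expanding along the bordering row writes
  \<open>d i\<close> as a linear form in row \<open>i\<close> of \<open>M\<close> whose coefficients do not depend on \<open>i\<close>, the
  coefficient of column \<open>j\<close> being \<open>det S\<close>.  For \<open>i > k\<close> two rows agree, so \<open>d i = 0\<close>, and hence
  the sum in question may be extended to all \<open>i \<le> n\<close>.  Summing against the cofactors of column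
  \<open>j\<close> of \<open>M\<close> then annihilates every column but \<open>j\<close> and leaves \<open>det M * det S\<close>.
\<close>

lemma pick_range:
  assumes "strict_mono (f :: nat \<Rightarrow> nat)"
  shows "pick (range f) m = f m"
proof (induction m)
  case 0
  show ?case
    using assms by (auto intro!: Least_equality simp: strict_mono_less_eq)
next
  case (Suc m)
  have "(LEAST a. a \<in> range f \<and> f m < a) = f (Suc m)"
    using assms by (intro Least_equality) (auto simp: strict_mono_less strict_mono_less_eq)
  then show ?case by (simp add: Suc)
qed

lemma card_less_range:
  assumes "strict_mono (f :: nat \<Rightarrow> nat)" and "\<And>m. f m < n \<longleftrightarrow> m < p"
  shows "card {a. a < n \<and> a \<in> range f} = p"
proof -
  have "{a. a < n \<and> a \<in> range f} = f ` {..<p}" using assms(2) by auto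
  moreover have "inj_on f {..<p}"
    using assms(1) by (meson inj_on_subset strict_mono_imp_inj_on subset_UNIV)
  ultimately show ?thesis by (simp add: card_image)
qed

text \<open>\<open>f\<close> and \<open>g\<close> enumerate the kept indices in increasing order, so
  position \<open>a\<close> of the submatrix comes from row \<open>f a\<close>. Each removal below
  reduces to exhibiting such an enumeration.\<close>

lemma submatrix_range:
  assumes "strict_mono f" "\<And>m. f m < dim_row A \<longleftrightarrow> m < p"
    and "strict_mono g" "\<And>m. g m < dim_col A \<longleftrightarrow> m < q"
  shows "submatrix A (range f) (range g) = mat p q (\<lambda>(a, b). A $$ (f a, g b))"
  using assms by (simp add: submatrix_def pick_range card_less_range)

lemma range_insert_index: "range (insert_index i) = {r. r \<noteq> i}"
proof -
  have "r \<in> range (insert_index i)" if "r \<noteq> i" for r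
    using that by (intro range_eqI[of _ _ "delete_index i r"])
      (auto simp: insert_index_def delete_index_def)
  then show ?thesis by (auto simp: insert_index_def split: if_splits)
qed

lemma strict_mono_insert_index: "strict_mono (insert_index i)"
  by (auto simp: strict_mono_def insert_index_def)

lemma remove_rows_cols_single:
  assumes "M \<in> carrier_mat n n" "i < n" "j < n"
  shows "remove_rows_cols M {Suc i} {Suc j} = mat_delete M i j"
proof -
  have keep: "{r. Suc r \<notin> {Suc x}} = range (insert_index x)" for x
    by (auto simp: range_insert_index)
  have dims: "insert_index x m < n \<longleftrightarrow> m < n - 1" if "x < n" for x m
    using that by (auto simp: insert_index_def)
  have "remove_rows_cols M {Suc i} {Suc j} =
      mat (n - 1) (n - 1) (\<lambda>(a, b). M $$ (insert_index i a, insert_index j b))"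
    unfolding remove_rows_cols_def keep
    using assms dims by (intro submatrix_range strict_mono_insert_index) auto
  also have "\<dots> = mat_delete M i j"
    using assms by (simp add: mat_delete_def insert_index_def)
  finally show ?thesis .
qed

lemma remove_rows_cols_initial:
  assumes "M \<in> carrier_mat n n"
  shows "remove_rows_cols M {1..k} {1..k} = mat (n - k) (n - k) (\<lambda>(a, b). M $$ (k + a, k + b))"
proof -
  have keep: "{r. Suc r \<notin> {1..k}} = range ((+) k)"
    by (auto simp: image_iff) presburger
  show ?thesis
    unfolding remove_rows_cols_def keep
    using assms by (intro submatrix_range) (auto simp: strict_mono_def)
qed

text \<open>The border \<open>x\<close> sits at position 0, ahead of the block indices
  \<open>k\<close>, \<open>k + 1\<close>, and so on. The value \<open>x \<ge> k\<close> is allowed: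
  it repeats an index, which no set of kept indices can express.\<close>

definition border_index :: "nat \<Rightarrow> nat \<Rightarrow> nat \<Rightarrow> nat" where
  "border_index k x m = (case m of 0 \<Rightarrow> x | Suc m' \<Rightarrow> k + m')"

lemma border_index_simps [simp]:
  "border_index k x 0 = x"
  "border_index k x (Suc m) = k + m"
  by (simp_all add: border_index_def)

definition bordered :: "'a mat \<Rightarrow> nat \<Rightarrow> nat \<Rightarrow> nat \<Rightarrow> nat \<Rightarrow> 'a mat" where
  "bordered M n k i j =
    mat (Suc (n - k)) (Suc (n - k)) (\<lambda>(a, b). M $$ (border_index k i a, border_index k j b))"

lemma bordered_carrier: "bordered M n k i j \<in> carrier_mat (Suc (n - k)) (Suc (n - k))"
  by (simp add: bordered_def)

text \<open>The borders \<open>i\<close> and \<open>j\<close> lie below \<open>k\<close>, so they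
  precede the block in increasing order too; no rows or columns are permuted and no sign
  appears.\<close>

lemma remove_rows_cols_bordered:
  assumes "M \<in> carrier_mat n n" "i < k" "j < k" "k \<le> n"
  shows "remove_rows_cols M ({1..k} - {Suc i}) ({1..k} - {Suc j}) = bordered M n k i j"
proof -
  have keep: "{r. Suc r \<notin> {1..k} - {Suc x}} = range (border_index k x)" if "x < k" for x
  proof -
    have "r \<in> range (border_index k x)" if "r = x \<or> k \<le> r" for r
      using that
    proof
      assume "k \<le> r"
      then show ?thesis by (intro range_eqI[of _ _ "Suc (r - k)"]) simp
    qed (intro range_eqI[of _ _ 0], simp)
    then show ?thesis using that by (auto simp: border_index_def split: nat.splits)
  qed
  have mono: "strict_mono (border_index k x)" if "x < k" for x
    using that by (auto simp: strict_mono_def border_index_def split: nat.splits)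
  have dims: "border_index k x m < n \<longleftrightarrow> m < Suc (n - k)" if "x < k" for x m
    using that assms(4) by (auto simp: border_index_def split: nat.splits)
  show ?thesis
    unfolding remove_rows_cols_def keep[OF assms(2)] keep[OF assms(3)] bordered_def
    using assms dims mono by (intro submatrix_range) auto
qed

lemma det_bordered_eq_0:
  assumes "k \<le> i" "i < n"
  shows "det (bordered M n k i j) = 0"
proof (rule det_identical_rows[OF bordered_carrier])
  \<comment> \<open>The border is row \<open>i\<close> of \<open>M\<close>, which recurs inside the
    block because \<open>k + (i - k) = i\<close>.\<close>
  show "row (bordered M n k i j) 0 = row (bordered M n k i j) (Suc (i - k))"
    using assms by (intro eq_vecI) (auto simp: bordered_def)
qed (use assms in auto)

text \<open>Only row 0 depends on \<open>i\<close>, and these cofactors delete it. The 0 on the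
  right is just a fixed representative.\<close>

lemma cofactor_bordered: "cofactor (bordered M n k i j) 0 m = cofactor (bordered M n k 0 j) 0 m"
  unfolding cofactor_def mat_delete_def bordered_def
  by (intro arg_cong2[where f = "(*)"] refl arg_cong[where f = det] eq_matI) auto

lemma cofactor_bordered_corner:
  "cofactor (bordered M n k i j) 0 0 = det (mat (n - k) (n - k) (\<lambda>(a, b). M $$ (k + a, k + b)))"
  unfolding cofactor_def mat_delete_def bordered_def
  by (simp, intro arg_cong[where f = det] eq_matI) auto

lemma det_bordered_expand:
  "det (bordered M n k i j) =
    (\<Sum>m<Suc (n - k). M $$ (i, border_index k j m) * cofactor (bordered M n k 0 j) 0 m)"
proof -
  have "det (bordered M n k i j) =
      (\<Sum>m<Suc (n - k). bordered M n k i j $$ (0, m) * cofactor (bordered M n k i j) 0 m)"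
    by (rule laplace_expansion_row[OF bordered_carrier]) simp
  also have "\<dots> = (\<Sum>m<Suc (n - k). M $$ (i, border_index k j m) * cofactor (bordered M n k 0 j) 0 m)"
    by (intro sum.cong refl arg_cong2[where f = "(*)"] cofactor_bordered) (auto simp: bordered_def)
  finally show ?thesis .
qed

text \<open>The sum is an entry of \<open>adj_mat M * M\<close>, which is \<open>det M\<close> times
  the identity.\<close>

lemma sum_cofactor_column:
  assumes "M \<in> carrier_mat n n" "j < n" "l < n"
  shows "(\<Sum>i<n. cofactor M i j * M $$ (i, l)) = (if l = j then det M else 0)"
proof -
  have "(\<Sum>i<n. cofactor M i j * M $$ (i, l)) = (adj_mat M * M) $$ (j, l)"
    using assms by (auto simp: adj_mat_def scalar_prod_def atLeast0LessThan)
  then show ?thesis using assms by (simp add: adj_mat(3))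
qed

lemma det_mult_block:
  assumes M: "M \<in> carrier_mat n n" and "j < k" "k \<le> n"
  shows "det M * det (mat (n - k) (n - k) (\<lambda>(a, b). M $$ (k + a, k + b))) =
    (\<Sum>i<k. cofactor M i j * det (bordered M n k i j))"
proof -
  define c where "c m = cofactor (bordered M n k 0 j) 0 m" for m
  have "(\<Sum>i<k. cofactor M i j * det (bordered M n k i j)) =
      (\<Sum>i<n. cofactor M i j * det (bordered M n k i j))"
    using assms by (intro sum.mono_neutral_left) (auto simp: det_bordered_eq_0)
  also have "\<dots> = (\<Sum>i<n. \<Sum>m<Suc (n - k). c m * (cofactor M i j * M $$ (i, border_index k j m)))"
    unfolding det_bordered_expand c_def sum_distrib_left by (simp only: mult_ac)
  also have "\<dots> = (\<Sum>m<Suc (n - k). c m * (\<Sum>i<n. cofactor M i j * M $$ (i, border_index k j m)))"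
    unfolding sum_distrib_left by (rule sum.swap)
  also have "\<dots> = (\<Sum>m<Suc (n - k). if m = 0 then c 0 * det M else 0)"
  proof (intro sum.cong refl)
    fix m assume "m \<in> {..<Suc (n - k)}"
    \<comment> \<open>For \<open>m > 0\<close> the column index is at least \<open>k\<close>, hence
      differs from \<open>j < k\<close>.\<close>
    then have "border_index k j m < n" "border_index k j m = j \<longleftrightarrow> m = 0"
      using assms by (auto simp: border_index_def split: nat.splits)
    then show "c m * (\<Sum>i<n. cofactor M i j * M $$ (i, border_index k j m)) =
        (if m = 0 then c 0 * det M else 0)"
      using assms by (simp add: sum_cofactor_column[OF M])
  qed
  also have "\<dots> = c 0 * det M" by simp
  finally show ?thesis by (simp add: c_def cofactor_bordered_corner mult.commute)
qed

theorem theorem2p1p4: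
  fixes M :: "'a :: comm_ring_1 mat" and n k j :: nat
  assumes "M \<in> carrier_mat n n"
    and "1 \<le> k" and "k \<le> n"
    and "1 \<le> j" and "j \<le> k"
  shows "det M * det (remove_rows_cols M {1..k} {1..k}) =
    (\<Sum>i = 1..k. (-1) ^ (i + j) * det (remove_rows_cols M {i} {j}) *
       det (remove_rows_cols M ({1..k} - {i}) ({1..k} - {j})))"
proof -
  define j' where "j' = j - 1"
  have j: "j = Suc j'" "j' < k" using assms by (auto simp: j'_def)
  have "det M * det (remove_rows_cols M {1..k} {1..k}) =
      (\<Sum>i<k. cofactor M i j' * det (bordered M n k i j'))"
    unfolding remove_rows_cols_initial[OF assms(1)] using assms j by (intro det_mult_block)
  also have "\<dots> = (\<Sum>i<k. (-1) ^ (Suc i + j) * det (remove_rows_cols M {Suc i} {j}) *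
       det (remove_rows_cols M ({1..k} - {Suc i}) ({1..k} - {j})))"
  proof (intro sum.cong refl)
    fix i assume "i \<in> {..<k}"
    then have i: "i < k" by simp
    have "remove_rows_cols M {Suc i} {j} = mat_delete M i j'"
      unfolding j(1) using assms i j by (intro remove_rows_cols_single[of _ n]) auto
    moreover have "remove_rows_cols M ({1..k} - {Suc i}) ({1..k} - {j}) = bordered M n k i j'"
      unfolding j(1) using assms i j by (intro remove_rows_cols_bordered) auto
    \<comment> \<open>Passing to 1-based indices raises the exponent of -1 by two, so the sign of
      the cofactor is unchanged.\<close>
    ultimately show "cofactor M i j' * det (bordered M n k i j') =
        (-1) ^ (Suc i + j) * det (remove_rows_cols M {Suc i} {j}) *
        det (remove_rows_cols M ({1..k} - {Suc i}) ({1..k} - {j}))"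
      by (simp add: cofactor_def j(1))
  qed
  also have "\<dots> = (\<Sum>i = 1..k. (-1) ^ (i + j) * det (remove_rows_cols M {i} {j}) *
       det (remove_rows_cols M ({1..k} - {i}) ({1..k} - {j})))"
    by (rule sum.reindex_bij_witness[of _ "\<lambda>i. i - 1" Suc]) auto
  finally show ?thesis .
qed

end
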